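(* Let $\mathbb{A}$ be a double category with conjoints, and let $f\colon A\to B$, $g\colon C\to D$ be horizontal arrows and $v\colon A\nrightarrow C$, $w\colon B\nrightarrow D$ vertical arrows of $\mathbb{A}$. (1) If $x\colon C\nrightarrow A$ is right adjoint to $v$ and $y\colon D\nrightarrow B$ is right adjoint to $w$, then there is a bijection between cells $\alpha$ with top $f$, left $v$, right $w$, bottom $g$, and coretrocells $\beta$ with top $g$, left $x$, right $y$, bottom $f$. (2) If $h\colon B\to A$ is right adjoint to $f$ and $k\colon D\to C$ is right adjoint to $g$, then there is a bijection between cells $\alpha$ with top $f$, left $v$, right $w$, bottom $g$, and coretrocells $\gamma$ with top $h$, left $w$, right $v$, bottom $k$.
   Context: Double categories. A double category $\mathbb{A}$ has objects, horizontal arrows (composed strictly: composite $gf$, identity $1_A$), vertical arrows $v\colon A\nrightarrow C$ (composite $w\bullet v$ meaning $v$ first, identity $\mathrm{id}_A$; vertical composition is associative up to coherent isomorphism, vertical identities are taken strict) and cells. A cell has a top $f\colon A\to B$, a bottom $g\colon C\to D$ (horizontal arrows), a left side $v\colon A\nrightarrow C$ and a right side $w\colon B\nrightarrow D$ (vertical arrows). $\alpha\mid\beta$ denotes horizontal pasting ($\alpha$ left of $\beta$) and $\frac{\alpha}{\beta}$ vertical pasting ($\alpha$ above $\beta$). A globular cell $v\Rightarrow w$ is a cell with left $v$, right $w$ and identity top and bottom; globular cells are the 2-cells of the vertical bicategory $\mathcal{V}ert\,\mathbb{A}$. Cells with identity vertical sides, going from their top to their bottom, are the 2-cells of the 2-category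 $\mathcal{H}or\,\mathbb{A}$ of horizontal arrows. Horizontal arrows are adjoint if they are so in $\mathcal{H}or\,\mathbb{A}$; vertical arrows are adjoint if they are so in $\mathcal{V}ert\,\mathbb{A}$. Conjoints. A conjoint of $f\colon A\to B$ is a vertical arrow $f^*\colon B\nrightarrow A$ with cells $\alpha_f$ (top $f$, left $\mathrm{id}_A$, right $f^*$, bottom $1_A$) and $\beta_f$ (top $1_B$, left $f^*$, right $\mathrm{id}_B$, bottom $f$) such that $\alpha_f\mid\beta_f=\mathrm{id}_f$ (vertical identity cell on $f$) and $\frac{\beta_f}{\alpha_f}=1_{f^*}$ (horizontal identity cell on $f^*$). "$\mathbb{A}$ has conjoints" means every horizontal arrow has a (chosen) conjoint, with $1_A^*=\mathrm{id}_A$. Coretrocells. A coretrocell with top $f\colon A\to B$, left $v\colon A\nrightarrow C$, right $w\colon B\nrightarrow D$, bottom $g\colon C\to D$ is a globular cell $g^*\bullet w\Rightarrow v\bullet f^*$ of $\mathbb{A}$. *)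

theory Defs
  imports Main
begin

text \<open>
  Double categories that are strict horizontally and weak vertically, with strict vertical units.
  Composites are written in the order of functions: \<open>g \<cdot> f\<close> is \<open>f\<close> followed by \<open>g\<close>, and \<open>w \<bullet> v\<close>
  is \<open>v\<close> followed by \<open>w\<close>.  Pastings are written in the order of the picture: \<open>\<alpha> \<parallel> \<beta>\<close> has
  \<open>\<alpha>\<close> on the left of \<open>\<beta>\<close>, and \<open>\<alpha> \<div> \<beta>\<close> has \<open>\<alpha>\<close> above \<open>\<beta>\<close>.

  The field \<open>hcid\<close> is the horizontal identity cell on a vertical arrow, \<open>vcid\<close> the vertical
  identity cell on a horizontal arrow, and \<open>assoc x w v\<close> is the constraint
  \<open>x \<bullet> (w \<bullet> v) \<Rightarrow> (x \<bullet> w) \<bullet> v\<close>, with inverse \<open>assoc_inv x w v\<close>.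
  All operations are meaningful only on the carriers and on composable arguments.
\<close>

record ('o, 'h, 'v, 'c) dblcat =
  Obj  :: "'o set"
  Hor  :: "'h set"
  Ver  :: "'v set"
  Cel  :: "'c set"
  hdom :: "'h \<Rightarrow> 'o"
  hcod :: "'h \<Rightarrow> 'o"
  hid  :: "'o \<Rightarrow> 'h"
  hcomp :: "'h \<Rightarrow> 'h \<Rightarrow> 'h" (infixr "\<cdot>\<index>" 70)
  vdom :: "'v \<Rightarrow> 'o"
  vcod :: "'v \<Rightarrow> 'o"
  vid  :: "'o \<Rightarrow> 'v"
  vcomp :: "'v \<Rightarrow> 'v \<Rightarrow> 'v" (infixr "\<bullet>\<index>" 70)
  ctop :: "'c \<Rightarrow> 'h"
  cleft :: "'c \<Rightarrow> 'v"
  cright :: "'c \<Rightarrow> 'v"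
  cbot :: "'c \<Rightarrow> 'h"
  hcid :: "'v \<Rightarrow> 'c"
  vcid :: "'h \<Rightarrow> 'c"
  hpaste :: "'c \<Rightarrow> 'c \<Rightarrow> 'c" (infixl "\<parallel>\<index>" 65)
  vpaste :: "'c \<Rightarrow> 'c \<Rightarrow> 'c" (infixl "\<div>\<index>" 68)
  assoc :: "'v \<Rightarrow> 'v \<Rightarrow> 'v \<Rightarrow> 'c"
  assoc_inv :: "'v \<Rightarrow> 'v \<Rightarrow> 'v \<Rightarrow> 'c"

definition harrow :: "('o,'h,'v,'c) dblcat \<Rightarrow> 'h \<Rightarrow> 'o \<Rightarrow> 'o \<Rightarrow> bool" where
  "harrow \<A> f a b \<longleftrightarrow> f \<in> Hor \<A> \<and> hdom \<A> f = a \<and> hcod \<A> f = b"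

definition varrow :: "('o,'h,'v,'c) dblcat \<Rightarrow> 'v \<Rightarrow> 'o \<Rightarrow> 'o \<Rightarrow> bool" where
  "varrow \<A> v a b \<longleftrightarrow> v \<in> Ver \<A> \<and> vdom \<A> v = a \<and> vcod \<A> v = b"

text \<open>The boundary of a cell is always listed in the order top, left, right, bottom.\<close>

definition cell :: "('o,'h,'v,'c) dblcat \<Rightarrow> 'c \<Rightarrow> 'h \<Rightarrow> 'v \<Rightarrow> 'v \<Rightarrow> 'h \<Rightarrow> bool" where
  "cell \<A> \<alpha> f v w g \<longleftrightarrow>
     \<alpha> \<in> Cel \<A> \<and> ctop \<A> \<alpha> = f \<and> cleft \<A> \<alpha> = v \<and> cright \<A> \<alpha> = w \<and> cbot \<A> \<alpha> = g"

text \<open>The 2-cells \<open>v \<Rightarrow> w\<close> of the vertical bicategory; they compose by \<open>\<parallel>\<close>.\<close>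

definition globular :: "('o,'h,'v,'c) dblcat \<Rightarrow> 'c \<Rightarrow> 'v \<Rightarrow> 'v \<Rightarrow> bool" where
  "globular \<A> \<alpha> v w \<longleftrightarrow> cell \<A> \<alpha> (hid \<A> (vdom \<A> v)) v w (hid \<A> (vcod \<A> v))"

text \<open>The 2-cells \<open>f \<Rightarrow> g\<close> of the horizontal 2-category; they compose by \<open>\<div>\<close>.\<close>

definition hor_2cell :: "('o,'h,'v,'c) dblcat \<Rightarrow> 'c \<Rightarrow> 'h \<Rightarrow> 'h \<Rightarrow> bool" where
  "hor_2cell \<A> \<alpha> f g \<longleftrightarrow> cell \<A> \<alpha> f (vid \<A> (hdom \<A> f)) (vid \<A> (hcod \<A> f)) g"

locale double_category =
  fixes \<A> :: "('o,'h,'v,'c) dblcat" (structure)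
  assumes hor_dom_cod: "f \<in> Hor \<A> \<Longrightarrow> hdom \<A> f \<in> Obj \<A> \<and> hcod \<A> f \<in> Obj \<A>"
    and hid_arrow: "a \<in> Obj \<A> \<Longrightarrow> harrow \<A> (hid \<A> a) a a"
    and hcomp_arrow: "\<lbrakk>harrow \<A> f a b; harrow \<A> g b c\<rbrakk> \<Longrightarrow> harrow \<A> (g \<cdot> f) a c"
    and hcomp_hid: "harrow \<A> f a b \<Longrightarrow> f \<cdot> hid \<A> a = f"
    and hid_hcomp: "harrow \<A> f a b \<Longrightarrow> hid \<A> b \<cdot> f = f"
    and hcomp_assoc:
      "\<lbrakk>harrow \<A> f a b; harrow \<A> g b c; harrow \<A> h c d\<rbrakk> \<Longrightarrow> h \<cdot> (g \<cdot> f) = (h \<cdot> g) \<cdot> f"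

    and ver_dom_cod: "v \<in> Ver \<A> \<Longrightarrow> vdom \<A> v \<in> Obj \<A> \<and> vcod \<A> v \<in> Obj \<A>"
    and vid_arrow: "a \<in> Obj \<A> \<Longrightarrow> varrow \<A> (vid \<A> a) a a"
    and vcomp_arrow: "\<lbrakk>varrow \<A> v a b; varrow \<A> w b c\<rbrakk> \<Longrightarrow> varrow \<A> (w \<bullet> v) a c"
    and vcomp_vid: "varrow \<A> v a b \<Longrightarrow> v \<bullet> vid \<A> a = v"
    and vid_vcomp: "varrow \<A> v a b \<Longrightarrow> vid \<A> b \<bullet> v = v"

    and cell_boundary: "cell \<A> \<alpha> f v w g \<Longrightarrow>
      f \<in> Hor \<A> \<and> g \<in> Hor \<A> \<and> v \<in> Ver \<A> \<and> w \<in> Ver \<A> \<and>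
      hdom \<A> f = vdom \<A> v \<and> hcod \<A> f = vdom \<A> w \<and>
      hdom \<A> g = vcod \<A> v \<and> hcod \<A> g = vcod \<A> w"

    and hcid_cell: "varrow \<A> v a b \<Longrightarrow> cell \<A> (hcid \<A> v) (hid \<A> a) v v (hid \<A> b)"
    and hpaste_cell:
      "\<lbrakk>cell \<A> \<alpha> f u v g; cell \<A> \<beta> f' v w g'\<rbrakk> \<Longrightarrow> cell \<A> (\<alpha> \<parallel> \<beta>) (f' \<cdot> f) u w (g' \<cdot> g)"
    and hcid_hpaste: "cell \<A> \<alpha> f v w g \<Longrightarrow> hcid \<A> v \<parallel> \<alpha> = \<alpha>"
    and hpaste_hcid: "cell \<A> \<alpha> f v w g \<Longrightarrow> \<alpha> \<parallel> hcid \<A> w = \<alpha>"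
    and hpaste_assoc:
      "\<lbrakk>cell \<A> \<alpha> f u v g; cell \<A> \<beta> f' v w g'; cell \<A> \<gamma> f'' w x g''\<rbrakk>
        \<Longrightarrow> (\<alpha> \<parallel> \<beta>) \<parallel> \<gamma> = \<alpha> \<parallel> (\<beta> \<parallel> \<gamma>)"

    and vcid_cell: "harrow \<A> f a b \<Longrightarrow> cell \<A> (vcid \<A> f) f (vid \<A> a) (vid \<A> b) f"
    and vpaste_cell:
      "\<lbrakk>cell \<A> \<alpha> f v w g; cell \<A> \<beta> g v' w' h\<rbrakk> \<Longrightarrow> cell \<A> (\<alpha> \<div> \<beta>) f (v' \<bullet> v) (w' \<bullet> w) h"
    and vcid_vpaste: "cell \<A> \<alpha> f v w g \<Longrightarrow> vcid \<A> f \<div> \<alpha> = \<alpha>"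
    and vpaste_vcid: "cell \<A> \<alpha> f v w g \<Longrightarrow> \<alpha> \<div> vcid \<A> g = \<alpha>"

    and interchange:
      "\<lbrakk>cell \<A> \<alpha> f u v g; cell \<A> \<beta> f' v w g'; cell \<A> \<gamma> g u' v' h; cell \<A> \<delta> g' v' w' h'\<rbrakk>
        \<Longrightarrow> (\<alpha> \<parallel> \<beta>) \<div> (\<gamma> \<parallel> \<delta>) = (\<alpha> \<div> \<gamma>) \<parallel> (\<beta> \<div> \<delta>)"
    and hcid_vpaste_hcid:
      "\<lbrakk>varrow \<A> v a b; varrow \<A> w b c\<rbrakk> \<Longrightarrow> hcid \<A> v \<div> hcid \<A> w = hcid \<A> (w \<bullet> v)"
    and vcid_hpaste_vcid:
      "\<lbrakk>harrow \<A> f a b; harrow \<A> g b c\<rbrakk> \<Longrightarrow> vcid \<A> f \<parallel> vcid \<A> g = vcid \<A> (g \<cdot> f)"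
    and hcid_vid: "a \<in> Obj \<A> \<Longrightarrow> hcid \<A> (vid \<A> a) = vcid \<A> (hid \<A> a)"

    and assoc_cell:
      "\<lbrakk>varrow \<A> v a b; varrow \<A> w b c; varrow \<A> x c d\<rbrakk>
        \<Longrightarrow> globular \<A> (assoc \<A> x w v) (x \<bullet> (w \<bullet> v)) ((x \<bullet> w) \<bullet> v)"
    and assoc_inv_cell:
      "\<lbrakk>varrow \<A> v a b; varrow \<A> w b c; varrow \<A> x c d\<rbrakk>
        \<Longrightarrow> globular \<A> (assoc_inv \<A> x w v) ((x \<bullet> w) \<bullet> v) (x \<bullet> (w \<bullet> v))"
    and assoc_hpaste_assoc_inv:
      "\<lbrakk>varrow \<A> v a b; varrow \<A> w b c; varrow \<A> x c d\<rbrakk>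
        \<Longrightarrow> assoc \<A> x w v \<parallel> assoc_inv \<A> x w v = hcid \<A> (x \<bullet> (w \<bullet> v))"
    and assoc_inv_hpaste_assoc:
      "\<lbrakk>varrow \<A> v a b; varrow \<A> w b c; varrow \<A> x c d\<rbrakk>
        \<Longrightarrow> assoc_inv \<A> x w v \<parallel> assoc \<A> x w v = hcid \<A> ((x \<bullet> w) \<bullet> v)"
    and assoc_natural:
      "\<lbrakk>cell \<A> \<alpha> f v v' g; cell \<A> \<beta> g w w' h; cell \<A> \<gamma> h x x' k\<rbrakk>
        \<Longrightarrow> ((\<alpha> \<div> \<beta>) \<div> \<gamma>) \<parallel> assoc \<A> x' w' v' = assoc \<A> x w v \<parallel> (\<alpha> \<div> (\<beta> \<div> \<gamma>))"
    and pentagon: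
      "\<lbrakk>varrow \<A> v a b; varrow \<A> w b c; varrow \<A> x c d; varrow \<A> y d e\<rbrakk>
        \<Longrightarrow> assoc \<A> y x (w \<bullet> v) \<parallel> assoc \<A> (y \<bullet> x) w v =
            (assoc \<A> x w v \<div> hcid \<A> y) \<parallel> assoc \<A> y (x \<bullet> w) v \<parallel> (hcid \<A> v \<div> assoc \<A> y x w)"
    \<comment> \<open>This is the triangle axiom, the unit constraints being identities.\<close>
    and triangle:
      "\<lbrakk>varrow \<A> v a b; varrow \<A> w b c\<rbrakk> \<Longrightarrow> assoc \<A> w (vid \<A> b) v = hcid \<A> (w \<bullet> v)"

text \<open>Adjunctions \<open>f \<stileturn> h\<close> in the horizontal 2-category, with \<open>f : A \<rightarrow> B\<close> and \<open>h : B \<rightarrow> A\<close>;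
  \<open>\<eta> : 1 \<Rightarrow> h \<cdot> f\<close> is the unit and \<open>\<epsilon> : f \<cdot> h \<Rightarrow> 1\<close> the counit.\<close>

definition hor_adjunction ::
    "('o,'h,'v,'c) dblcat \<Rightarrow> 'h \<Rightarrow> 'h \<Rightarrow> 'c \<Rightarrow> 'c \<Rightarrow> bool" where
  "hor_adjunction \<A> f h \<eta> \<epsilon> \<longleftrightarrow>
     harrow \<A> h (hcod \<A> f) (hdom \<A> f) \<and> harrow \<A> f (hdom \<A> f) (hcod \<A> f) \<and>
     hor_2cell \<A> \<eta> (hid \<A> (hdom \<A> f)) (h \<cdot>\<^bsub>\<A>\<^esub> f) \<and>
     hor_2cell \<A> \<epsilon> (f \<cdot>\<^bsub>\<A>\<^esub> h) (hid \<A> (hcod \<A> f)) \<and>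
     (\<eta> \<parallel>\<^bsub>\<A>\<^esub> vcid \<A> f) \<div>\<^bsub>\<A>\<^esub> (vcid \<A> f \<parallel>\<^bsub>\<A>\<^esub> \<epsilon>) = vcid \<A> f \<and>
     (vcid \<A> h \<parallel>\<^bsub>\<A>\<^esub> \<eta>) \<div>\<^bsub>\<A>\<^esub> (\<epsilon> \<parallel>\<^bsub>\<A>\<^esub> vcid \<A> h) = vcid \<A> h"

definition hor_right_adjoint :: "('o,'h,'v,'c) dblcat \<Rightarrow> 'h \<Rightarrow> 'h \<Rightarrow> bool" where
  "hor_right_adjoint \<A> h f \<longleftrightarrow> (\<exists>\<eta> \<epsilon>. hor_adjunction \<A> f h \<eta> \<epsilon>)"

text \<open>Adjunctions \<open>v \<stileturn> x\<close> in the vertical bicategory, with unit \<open>\<eta> : id \<Rightarrow> x \<bullet> v\<close> and counit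
  \<open>\<epsilon> : v \<bullet> x \<Rightarrow> id\<close>.\<close>

definition ver_adjunction ::
    "('o,'h,'v,'c) dblcat \<Rightarrow> 'v \<Rightarrow> 'v \<Rightarrow> 'c \<Rightarrow> 'c \<Rightarrow> bool" where
  "ver_adjunction \<A> v x \<eta> \<epsilon> \<longleftrightarrow>
     varrow \<A> x (vcod \<A> v) (vdom \<A> v) \<and> varrow \<A> v (vdom \<A> v) (vcod \<A> v) \<and>
     globular \<A> \<eta> (vid \<A> (vdom \<A> v)) (x \<bullet>\<^bsub>\<A>\<^esub> v) \<and>
     globular \<A> \<epsilon> (v \<bullet>\<^bsub>\<A>\<^esub> x) (vid \<A> (vcod \<A> v)) \<and>
     (\<eta> \<div>\<^bsub>\<A>\<^esub> hcid \<A> v) \<parallel>\<^bsub>\<A>\<^esub> assoc \<A> v x v \<parallel>\<^bsub>\<A>\<^esub> (hcid \<A> v \<div>\<^bsub>\<A>\<^esub> \<epsilon>) = hcid \<A> v \<and>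
     (hcid \<A> x \<div>\<^bsub>\<A>\<^esub> \<eta>) \<parallel>\<^bsub>\<A>\<^esub> assoc_inv \<A> x v x \<parallel>\<^bsub>\<A>\<^esub> (\<epsilon> \<div>\<^bsub>\<A>\<^esub> hcid \<A> x) = hcid \<A> x"

definition ver_right_adjoint :: "('o,'h,'v,'c) dblcat \<Rightarrow> 'v \<Rightarrow> 'v \<Rightarrow> bool" where
  "ver_right_adjoint \<A> x v \<longleftrightarrow> (\<exists>\<eta> \<epsilon>. ver_adjunction \<A> v x \<eta> \<epsilon>)"

definition is_conjoint ::
    "('o,'h,'v,'c) dblcat \<Rightarrow> 'h \<Rightarrow> 'v \<Rightarrow> 'c \<Rightarrow> 'c \<Rightarrow> bool" where
  "is_conjoint \<A> f p \<alpha> \<beta> \<longleftrightarrow>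
     varrow \<A> p (hcod \<A> f) (hdom \<A> f) \<and>
     cell \<A> \<alpha> f (vid \<A> (hdom \<A> f)) p (hid \<A> (hdom \<A> f)) \<and>
     cell \<A> \<beta> (hid \<A> (hcod \<A> f)) p (vid \<A> (hcod \<A> f)) f \<and>
     \<alpha> \<parallel>\<^bsub>\<A>\<^esub> \<beta> = vcid \<A> f \<and>
     \<beta> \<div>\<^bsub>\<A>\<^esub> \<alpha> = hcid \<A> p"

text \<open>A double category with a choice of conjoints: \<open>cj f\<close> is the conjoint \<open>f\<^sup>*\<close>, and \<open>cj\<alpha> f\<close>,
  \<open>cj\<beta> f\<close> are its structure cells.\<close>

locale double_category_with_conjoints = double_category \<A>
  for \<A> :: "('o,'h,'v,'c) dblcat" (structure) +
  fixes cj :: "'h \<Rightarrow> 'v" and cj\<alpha> cj\<beta> :: "'h \<Rightarrow> 'c"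
  assumes conjoint: "f \<in> Hor \<A> \<Longrightarrow> is_conjoint \<A> f (cj f) (cj\<alpha> f) (cj\<beta> f)"
    and conjoint_hid: "a \<in> Obj \<A> \<Longrightarrow> cj (hid \<A> a) = vid \<A> a"

definition cells ::
    "('o,'h,'v,'c) dblcat \<Rightarrow> 'h \<Rightarrow> 'v \<Rightarrow> 'v \<Rightarrow> 'h \<Rightarrow> 'c set" where
  "cells \<A> f v w g = {\<alpha>. cell \<A> \<alpha> f v w g}"

definition coretrocells ::
    "('o,'h,'v,'c) dblcat \<Rightarrow> ('h \<Rightarrow> 'v) \<Rightarrow> 'h \<Rightarrow> 'v \<Rightarrow> 'v \<Rightarrow> 'h \<Rightarrow> 'c set" where
  "coretrocells \<A> cj f v w g = {\<beta>. globular \<A> \<beta> (cj g \<bullet>\<^bsub>\<A>\<^esub> w) (v \<bullet>\<^bsub>\<A>\<^esub> cj f)}"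

end

theory Submission
  imports Defs "HOL-Library.Equipollence"
begin

text \<open>
  Pasting with the structure cells of a conjoint \<open>f\<^sup>*\<close> turns the top \<open>f\<close> of a cell into an identity at
  the price of composing the left side with \<open>f\<^sup>*\<close>; in the same way the bottom \<open>g\<close> moves to the right
  side.  Cells with boundary \<open>f, v, w, g\<close> are therefore the 2-cells \<open>v \<bullet> f\<^sup>* \<Rightarrow> g\<^sup>* \<bullet> w\<close> of the vertical
  bicategory (\<open>eqpoll_cells_conjoints\<close>).

  For the first part it remains to take mates.  The adjunction \<open>v \<stileturn> x\<close> carries \<open>v\<close> to the right of
  such a 2-cell, which becomes \<open>f\<^sup>* \<Rightarrow> x \<bullet> (g\<^sup>* \<bullet> w)\<close> (\<open>bij_betw_mate_left\<close>); after reassociating, the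
  adjunction \<open>w \<stileturn> y\<close> carries \<open>w\<close> to the left, which leaves \<open>f\<^sup>* \<bullet> y \<Rightarrow> x \<bullet> g\<^sup>*\<close>
  (\<open>eqpoll_mate_right\<close>), a coretrocell.

  For the second part, \<open>f \<stileturn> h\<close> makes the conjoint \<open>h\<^sup>*\<close> of the right adjoint a companion of \<open>f\<close>, that
  is, a conjoint of \<open>f\<close> in the double category \<open>\<A>\<close> with left and right exchanged
  (\<open>conjoint_of_right_adjoint_is_companion\<close>).  The description of cells by conjoints, read in that
  double category, says that cells with boundary \<open>f, v, w, g\<close> are the 2-cells
  \<open>k\<^sup>* \<bullet> v \<Rightarrow> w \<bullet> h\<^sup>*\<close>, which are the coretrocells in question.

  Each computation with cells is done once and transported by two dualities: the exchange of left
  and right, and the half turn, which reverses both directions.  The first shows that the two maps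
  between mates are inverse on both sides; the second turns statements about the top and left of a
  cell into statements about the bottom and right.
\<close>

section \<open>Boundaries of pasted cells\<close>

text \<open>
  The axioms are restated as conditional rewrite rules whose premises concern only membership and
  boundaries.  The simplifier can discharge these premises by computing boundaries of composites, so
  that later calculations need no side proofs.  Horizontal pastings are kept nested to the right.
\<close>

context double_category
begin

lemma hor_obj [simp]:
  "f \<in> Hor \<A> \<Longrightarrow> hdom \<A> f \<in> Obj \<A>" "f \<in> Hor \<A> \<Longrightarrow> hcod \<A> f \<in> Obj \<A>"
  using hor_dom_cod by auto

lemma hid_simps [simp]:
  assumes "a \<in> Obj \<A>"
  shows "hid \<A> a \<in> Hor \<A>" "hdom \<A> (hid \<A> a) = a" "hcod \<A> (hid \<A> a) = a"
  using hid_arrow[OF assms] by (auto simp: harrow_def)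

lemma hcomp_simps [simp]:
  assumes "f \<in> Hor \<A>" "g \<in> Hor \<A>" "hcod \<A> f = hdom \<A> g"
  shows "g \<cdot> f \<in> Hor \<A>" "hdom \<A> (g \<cdot> f) = hdom \<A> f" "hcod \<A> (g \<cdot> f) = hcod \<A> g"
  using hcomp_arrow[of f "hdom \<A> f" "hcod \<A> f" g "hcod \<A> g"] assms by (auto simp: harrow_def)

lemma hcomp_units [simp]:
  "\<lbrakk>f \<in> Hor \<A>; hdom \<A> f = a\<rbrakk> \<Longrightarrow> f \<cdot> hid \<A> a = f"
  "\<lbrakk>f \<in> Hor \<A>; hcod \<A> f = b\<rbrakk> \<Longrightarrow> hid \<A> b \<cdot> f = f"
  using hcomp_hid[of f a "hcod \<A> f"] hid_hcomp[of f "hdom \<A> f" b] by (auto simp: harrow_def)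

lemma hcomp_assoc_simp [simp]:
  "\<lbrakk>f \<in> Hor \<A>; g \<in> Hor \<A>; h \<in> Hor \<A>; hcod \<A> f = hdom \<A> g; hcod \<A> g = hdom \<A> h\<rbrakk>
    \<Longrightarrow> (h \<cdot> g) \<cdot> f = h \<cdot> (g \<cdot> f)"
  using hcomp_assoc[of f "hdom \<A> f" "hcod \<A> f" g "hcod \<A> g" h "hcod \<A> h"]
  by (simp add: harrow_def)

lemma ver_obj [simp]:
  "v \<in> Ver \<A> \<Longrightarrow> vdom \<A> v \<in> Obj \<A>" "v \<in> Ver \<A> \<Longrightarrow> vcod \<A> v \<in> Obj \<A>"
  using ver_dom_cod by auto

lemma vid_simps [simp]:
  assumes "a \<in> Obj \<A>"
  shows "vid \<A> a \<in> Ver \<A>" "vdom \<A> (vid \<A> a) = a" "vcod \<A> (vid \<A> a) = a"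
  using vid_arrow[OF assms] by (auto simp: varrow_def)

lemma vcomp_simps [simp]:
  assumes "v \<in> Ver \<A>" "w \<in> Ver \<A>" "vcod \<A> v = vdom \<A> w"
  shows "w \<bullet> v \<in> Ver \<A>" "vdom \<A> (w \<bullet> v) = vdom \<A> v" "vcod \<A> (w \<bullet> v) = vcod \<A> w"
  using vcomp_arrow[of v "vdom \<A> v" "vcod \<A> v" w "vcod \<A> w"] assms by (auto simp: varrow_def)

lemma vcomp_units [simp]:
  "\<lbrakk>v \<in> Ver \<A>; vdom \<A> v = a\<rbrakk> \<Longrightarrow> v \<bullet> vid \<A> a = v"
  "\<lbrakk>v \<in> Ver \<A>; vcod \<A> v = b\<rbrakk> \<Longrightarrow> vid \<A> b \<bullet> v = v"
  using vcomp_vid[of v a "vcod \<A> v"] vid_vcomp[of v "vdom \<A> v" b] by (auto simp: varrow_def)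

lemma cell_sides [simp]:
  assumes "\<alpha> \<in> Cel \<A>"
  shows "ctop \<A> \<alpha> \<in> Hor \<A>" "cbot \<A> \<alpha> \<in> Hor \<A>" "cleft \<A> \<alpha> \<in> Ver \<A>" "cright \<A> \<alpha> \<in> Ver \<A>"
    "hdom \<A> (ctop \<A> \<alpha>) = vdom \<A> (cleft \<A> \<alpha>)" "hcod \<A> (ctop \<A> \<alpha>) = vdom \<A> (cright \<A> \<alpha>)"
    "hdom \<A> (cbot \<A> \<alpha>) = vcod \<A> (cleft \<A> \<alpha>)" "hcod \<A> (cbot \<A> \<alpha>) = vcod \<A> (cright \<A> \<alpha>)"
  using cell_boundary[of \<alpha>] assms by (auto simp: cell_def)

lemma cell_facts:
  assumes "cell \<A> \<alpha> f v w g"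
  shows "\<alpha> \<in> Cel \<A>" "ctop \<A> \<alpha> = f" "cleft \<A> \<alpha> = v" "cright \<A> \<alpha> = w" "cbot \<A> \<alpha> = g"
    "f \<in> Hor \<A>" "g \<in> Hor \<A>" "hdom \<A> f = vdom \<A> v" "hcod \<A> f = vdom \<A> w"
    "hdom \<A> g = vcod \<A> v" "hcod \<A> g = vcod \<A> w"
  using assms cell_boundary[OF assms] by (auto simp: cell_def)

lemma hcid_simps [simp]:
  assumes "v \<in> Ver \<A>"
  shows "hcid \<A> v \<in> Cel \<A>" "ctop \<A> (hcid \<A> v) = hid \<A> (vdom \<A> v)" "cleft \<A> (hcid \<A> v) = v"
    "cright \<A> (hcid \<A> v) = v" "cbot \<A> (hcid \<A> v) = hid \<A> (vcod \<A> v)"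
  using hcid_cell[of v] assms by (auto simp: cell_def varrow_def)

lemma vcid_simps [simp]:
  assumes "f \<in> Hor \<A>"
  shows "vcid \<A> f \<in> Cel \<A>" "ctop \<A> (vcid \<A> f) = f" "cbot \<A> (vcid \<A> f) = f"
    "cleft \<A> (vcid \<A> f) = vid \<A> (hdom \<A> f)" "cright \<A> (vcid \<A> f) = vid \<A> (hcod \<A> f)"
  using vcid_cell[of f] assms by (auto simp: cell_def harrow_def)

lemma hpaste_simps [simp]:
  assumes "\<alpha> \<in> Cel \<A>" "\<beta> \<in> Cel \<A>" "cright \<A> \<alpha> = cleft \<A> \<beta>"
  shows "\<alpha> \<parallel> \<beta> \<in> Cel \<A>" "ctop \<A> (\<alpha> \<parallel> \<beta>) = ctop \<A> \<beta> \<cdot> ctop \<A> \<alpha>"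
    "cleft \<A> (\<alpha> \<parallel> \<beta>) = cleft \<A> \<alpha>" "cright \<A> (\<alpha> \<parallel> \<beta>) = cright \<A> \<beta>"
    "cbot \<A> (\<alpha> \<parallel> \<beta>) = cbot \<A> \<beta> \<cdot> cbot \<A> \<alpha>"
  using hpaste_cell[of \<alpha> _ _ _ _ \<beta>] assms by (auto simp: cell_def)

lemma vpaste_simps [simp]:
  assumes "\<alpha> \<in> Cel \<A>" "\<beta> \<in> Cel \<A>" "cbot \<A> \<alpha> = ctop \<A> \<beta>"
  shows "\<alpha> \<div> \<beta> \<in> Cel \<A>" "ctop \<A> (\<alpha> \<div> \<beta>) = ctop \<A> \<alpha>"
    "cleft \<A> (\<alpha> \<div> \<beta>) = cleft \<A> \<beta> \<bullet> cleft \<A> \<alpha>"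
    "cright \<A> (\<alpha> \<div> \<beta>) = cright \<A> \<beta> \<bullet> cright \<A> \<alpha>" "cbot \<A> (\<alpha> \<div> \<beta>) = cbot \<A> \<beta>"
  using vpaste_cell[of \<alpha> _ _ _ _ \<beta>] assms by (auto simp: cell_def)

lemma hpaste_units [simp]:
  "\<lbrakk>\<alpha> \<in> Cel \<A>; cleft \<A> \<alpha> = v\<rbrakk> \<Longrightarrow> hcid \<A> v \<parallel> \<alpha> = \<alpha>"
  "\<lbrakk>\<alpha> \<in> Cel \<A>; cright \<A> \<alpha> = v\<rbrakk> \<Longrightarrow> \<alpha> \<parallel> hcid \<A> v = \<alpha>"
  using hcid_hpaste[of \<alpha>] hpaste_hcid[of \<alpha>] by (auto simp: cell_def)

lemma vpaste_units [simp]: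
  "\<lbrakk>\<alpha> \<in> Cel \<A>; ctop \<A> \<alpha> = f\<rbrakk> \<Longrightarrow> vcid \<A> f \<div> \<alpha> = \<alpha>"
  "\<lbrakk>\<alpha> \<in> Cel \<A>; cbot \<A> \<alpha> = f\<rbrakk> \<Longrightarrow> \<alpha> \<div> vcid \<A> f = \<alpha>"
  using vcid_vpaste[of \<alpha>] vpaste_vcid[of \<alpha>] by (auto simp: cell_def)

lemma hcid_vid_simp [simp]: "a \<in> Obj \<A> \<Longrightarrow> hcid \<A> (vid \<A> a) = vcid \<A> (hid \<A> a)"
  by (rule hcid_vid)

lemma hpaste_vcid_hid [simp]:
  "\<lbrakk>\<alpha> \<in> Cel \<A>; a \<in> Obj \<A>; cleft \<A> \<alpha> = vid \<A> a\<rbrakk> \<Longrightarrow> vcid \<A> (hid \<A> a) \<parallel> \<alpha> = \<alpha>"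
  "\<lbrakk>\<alpha> \<in> Cel \<A>; a \<in> Obj \<A>; cright \<A> \<alpha> = vid \<A> a\<rbrakk> \<Longrightarrow> \<alpha> \<parallel> vcid \<A> (hid \<A> a) = \<alpha>"
  using hpaste_units hcid_vid by metis+

lemma hpaste_assoc_simp [simp]:
  "\<lbrakk>\<alpha> \<in> Cel \<A>; \<beta> \<in> Cel \<A>; \<gamma> \<in> Cel \<A>; cright \<A> \<alpha> = cleft \<A> \<beta>; cright \<A> \<beta> = cleft \<A> \<gamma>\<rbrakk>
    \<Longrightarrow> (\<alpha> \<parallel> \<beta>) \<parallel> \<gamma> = \<alpha> \<parallel> (\<beta> \<parallel> \<gamma>)"
  using hpaste_assoc[of \<alpha> _ _ _ _ \<beta> _ _ _ \<gamma>] by (auto simp: cell_def)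

lemma paste_interchange:
  "\<lbrakk>\<alpha> \<in> Cel \<A>; \<beta> \<in> Cel \<A>; \<gamma> \<in> Cel \<A>; \<delta> \<in> Cel \<A>; cright \<A> \<alpha> = cleft \<A> \<beta>;
    cright \<A> \<gamma> = cleft \<A> \<delta>; cbot \<A> \<alpha> = ctop \<A> \<gamma>; cbot \<A> \<beta> = ctop \<A> \<delta>\<rbrakk>
    \<Longrightarrow> (\<alpha> \<parallel> \<beta>) \<div> (\<gamma> \<parallel> \<delta>) = (\<alpha> \<div> \<gamma>) \<parallel> (\<beta> \<div> \<delta>)"
  using interchange[of \<alpha> _ _ _ _ \<beta> _ _ _ \<gamma>] by (auto simp: cell_def)

lemma vpaste_hcid [simp]:
  "\<lbrakk>v \<in> Ver \<A>; w \<in> Ver \<A>; vcod \<A> v = vdom \<A> w\<rbrakk>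
    \<Longrightarrow> hcid \<A> v \<div> hcid \<A> w = hcid \<A> (w \<bullet> v)"
  using hcid_vpaste_hcid[of v _ _ w] by (simp add: varrow_def)

lemma hpaste_vcid [simp]:
  "\<lbrakk>f \<in> Hor \<A>; g \<in> Hor \<A>; hcod \<A> f = hdom \<A> g\<rbrakk>
    \<Longrightarrow> vcid \<A> f \<parallel> vcid \<A> g = vcid \<A> (g \<cdot> f)"
  using vcid_hpaste_vcid[of f _ _ g] by (simp add: harrow_def)

lemma assoc_simps [simp]:
  assumes "v \<in> Ver \<A>" "w \<in> Ver \<A>" "x \<in> Ver \<A>" "vcod \<A> v = vdom \<A> w" "vcod \<A> w = vdom \<A> x"
  shows "assoc \<A> x w v \<in> Cel \<A>" "ctop \<A> (assoc \<A> x w v) = hid \<A> (vdom \<A> v)"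
    "cleft \<A> (assoc \<A> x w v) = x \<bullet> (w \<bullet> v)" "cright \<A> (assoc \<A> x w v) = (x \<bullet> w) \<bullet> v"
    "cbot \<A> (assoc \<A> x w v) = hid \<A> (vcod \<A> x)"
    "assoc_inv \<A> x w v \<in> Cel \<A>" "ctop \<A> (assoc_inv \<A> x w v) = hid \<A> (vdom \<A> v)"
    "cleft \<A> (assoc_inv \<A> x w v) = (x \<bullet> w) \<bullet> v" "cright \<A> (assoc_inv \<A> x w v) = x \<bullet> (w \<bullet> v)"
    "cbot \<A> (assoc_inv \<A> x w v) = hid \<A> (vcod \<A> x)"
    "assoc \<A> x w v \<parallel> assoc_inv \<A> x w v = hcid \<A> (x \<bullet> (w \<bullet> v))"
    "assoc_inv \<A> x w v \<parallel> assoc \<A> x w v = hcid \<A> ((x \<bullet> w) \<bullet> v)"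
  using assoc_cell[of v _ _ w _ x] assoc_inv_cell[of v _ _ w _ x]
    assoc_hpaste_assoc_inv[of v _ _ w _ x] assoc_inv_hpaste_assoc[of v _ _ w _ x] assms
  by (auto simp: varrow_def globular_def cell_def)

lemma assoc_naturality:
  "\<lbrakk>\<alpha> \<in> Cel \<A>; \<beta> \<in> Cel \<A>; \<gamma> \<in> Cel \<A>; cbot \<A> \<alpha> = ctop \<A> \<beta>; cbot \<A> \<beta> = ctop \<A> \<gamma>\<rbrakk>
    \<Longrightarrow> ((\<alpha> \<div> \<beta>) \<div> \<gamma>) \<parallel> assoc \<A> (cright \<A> \<gamma>) (cright \<A> \<beta>) (cright \<A> \<alpha>) =
        assoc \<A> (cleft \<A> \<gamma>) (cleft \<A> \<beta>) (cleft \<A> \<alpha>) \<parallel> (\<alpha> \<div> (\<beta> \<div> \<gamma>))"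
  using assoc_natural[of \<alpha> _ _ _ _ \<beta> _ _ _ \<gamma>] by (auto simp: cell_def)

lemma assoc_pentagon:
  "\<lbrakk>v \<in> Ver \<A>; w \<in> Ver \<A>; x \<in> Ver \<A>; y \<in> Ver \<A>; vcod \<A> v = vdom \<A> w; vcod \<A> w = vdom \<A> x;
    vcod \<A> x = vdom \<A> y\<rbrakk>
   \<Longrightarrow> assoc \<A> y x (w \<bullet> v) \<parallel> assoc \<A> (y \<bullet> x) w v =
            (assoc \<A> x w v \<div> hcid \<A> y) \<parallel> (assoc \<A> y (x \<bullet> w) v \<parallel> (hcid \<A> v \<div> assoc \<A> y x w))"
  using pentagon[of v _ _ w _ x _ y] by (simp add: varrow_def)

section \<open>Coherence\<close>

lemma assoc_unit_middle [simp]: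
  "\<lbrakk>v \<in> Ver \<A>; w \<in> Ver \<A>; vcod \<A> v = b; vdom \<A> w = b\<rbrakk>
    \<Longrightarrow> assoc \<A> w (vid \<A> b) v = hcid \<A> (w \<bullet> v)"
  using triangle[of v _ _ w] by (simp add: varrow_def)

lemma assoc_inv_cancel [simp]:
  assumes "v \<in> Ver \<A>" "w \<in> Ver \<A>" "x \<in> Ver \<A>" "vcod \<A> v = vdom \<A> w" "vcod \<A> w = vdom \<A> x"
    "\<gamma> \<in> Cel \<A>"
  shows "cleft \<A> \<gamma> = x \<bullet> (w \<bullet> v) \<Longrightarrow> assoc \<A> x w v \<parallel> (assoc_inv \<A> x w v \<parallel> \<gamma>) = \<gamma>"
    "cleft \<A> \<gamma> = (x \<bullet> w) \<bullet> v \<Longrightarrow> assoc_inv \<A> x w v \<parallel> (assoc \<A> x w v \<parallel> \<gamma>) = \<gamma>"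
  using assms by (simp_all flip: hpaste_assoc_simp)

text \<open>Kelly's argument: in a pentagon with two unit arrows at one end, the triangle axiom removes all
  constraints but three, and the two sides differ by one copy of the constraint in question, which is invertible.\<close>

lemma assoc_unit_right [simp]:
  assumes "v \<in> Ver \<A>" "w \<in> Ver \<A>" "vcod \<A> v = vdom \<A> w" "vdom \<A> v = a"
  shows "assoc \<A> w v (vid \<A> a) = hcid \<A> (w \<bullet> v)"
proof -
  have a: "a \<in> Obj \<A>" using assms by auto
  have "assoc_inv \<A> w v (vid \<A> a) \<parallel> (assoc \<A> w v (vid \<A> a) \<parallel> assoc \<A> w v (vid \<A> a))
      = assoc_inv \<A> w v (vid \<A> a) \<parallel> assoc \<A> w v (vid \<A> a)"
    using assoc_pentagon[of "vid \<A> a" "vid \<A> a" v w] assms a by simp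
  then show ?thesis using assms a by simp
qed

lemma assoc_unit_left [simp]:
  assumes "v \<in> Ver \<A>" "w \<in> Ver \<A>" "vcod \<A> v = vdom \<A> w" "vcod \<A> w = c"
  shows "assoc \<A> (vid \<A> c) w v = hcid \<A> (w \<bullet> v)"
proof -
  have c: "c \<in> Obj \<A>" using assms by auto
  have "assoc_inv \<A> (vid \<A> c) w v \<parallel> (assoc \<A> (vid \<A> c) w v \<parallel> assoc \<A> (vid \<A> c) w v)
      = assoc_inv \<A> (vid \<A> c) w v \<parallel> assoc \<A> (vid \<A> c) w v"
    using assoc_pentagon[of v w "vid \<A> c" "vid \<A> c"] assms c by simp
  then show ?thesis using assms c by simp
qed

lemma assoc_inv_natural:
  assumes "\<alpha> \<in> Cel \<A>" "\<beta> \<in> Cel \<A>" "\<gamma> \<in> Cel \<A>" "cbot \<A> \<alpha> = ctop \<A> \<beta>" "cbot \<A> \<beta> = ctop \<A> \<gamma>"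
  shows "(\<alpha> \<div> (\<beta> \<div> \<gamma>)) \<parallel> assoc_inv \<A> (cright \<A> \<gamma>) (cright \<A> \<beta>) (cright \<A> \<alpha>) =
        assoc_inv \<A> (cleft \<A> \<gamma>) (cleft \<A> \<beta>) (cleft \<A> \<alpha>) \<parallel> ((\<alpha> \<div> \<beta>) \<div> \<gamma>)"
    (is "?r \<parallel> ?J = ?I \<parallel> ?l")
proof -
  have m: "vcod \<A> (cleft \<A> \<alpha>) = vdom \<A> (cleft \<A> \<beta>)" "vcod \<A> (cright \<A> \<alpha>) = vdom \<A> (cright \<A> \<beta>)"
    "vcod \<A> (cleft \<A> \<beta>) = vdom \<A> (cleft \<A> \<gamma>)" "vcod \<A> (cright \<A> \<beta>) = vdom \<A> (cright \<A> \<gamma>)"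
    using assms cell_sides by metis+
  let ?A = "assoc \<A> (cleft \<A> \<gamma>) (cleft \<A> \<beta>) (cleft \<A> \<alpha>)"
  let ?B = "assoc \<A> (cright \<A> \<gamma>) (cright \<A> \<beta>) (cright \<A> \<alpha>)"
  have "?r \<parallel> ?J = ?I \<parallel> ((?A \<parallel> ?r) \<parallel> ?J)" using assms m by simp
  also have "\<dots> = ?I \<parallel> ((?l \<parallel> ?B) \<parallel> ?J)" using assoc_naturality assms by simp
  also have "\<dots> = ?I \<parallel> ?l" using assms m by simp
  finally show ?thesis .
qed

lemma whisker_below:
  "\<lbrakk>\<alpha> \<in> Cel \<A>; \<beta> \<in> Cel \<A>; cright \<A> \<alpha> = cleft \<A> \<beta>; v \<in> Ver \<A>;
    cbot \<A> \<alpha> = hid \<A> (vdom \<A> v); cbot \<A> \<beta> = hid \<A> (vdom \<A> v)\<rbrakk>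
    \<Longrightarrow> (\<alpha> \<parallel> \<beta>) \<div> hcid \<A> v = (\<alpha> \<div> hcid \<A> v) \<parallel> (\<beta> \<div> hcid \<A> v)"
  using paste_interchange[of \<alpha> \<beta> "hcid \<A> v" "hcid \<A> v"] by simp

lemma whisker_above:
  "\<lbrakk>\<alpha> \<in> Cel \<A>; \<beta> \<in> Cel \<A>; cright \<A> \<alpha> = cleft \<A> \<beta>; v \<in> Ver \<A>;
    ctop \<A> \<alpha> = hid \<A> (vcod \<A> v); ctop \<A> \<beta> = hid \<A> (vcod \<A> v)\<rbrakk>
    \<Longrightarrow> hcid \<A> v \<div> (\<alpha> \<parallel> \<beta>) = (hcid \<A> v \<div> \<alpha>) \<parallel> (hcid \<A> v \<div> \<beta>)"
  using paste_interchange[of "hcid \<A> v" "hcid \<A> v" \<alpha> \<beta>] by simp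

lemma pentagon_inv:
  assumes "v \<in> Ver \<A>" "w \<in> Ver \<A>" "x \<in> Ver \<A>" "y \<in> Ver \<A>" "vcod \<A> v = vdom \<A> w"
    "vcod \<A> w = vdom \<A> x" "vcod \<A> x = vdom \<A> y"
  shows "assoc_inv \<A> (y \<bullet> x) w v \<parallel> assoc_inv \<A> y x (w \<bullet> v) =
    (hcid \<A> v \<div> assoc_inv \<A> y x w) \<parallel> (assoc_inv \<A> y (x \<bullet> w) v \<parallel> (assoc_inv \<A> x w v \<div> hcid \<A> y))"
    (is "?L = ?R")
proof -
  let ?P = "assoc \<A> y x (w \<bullet> v) \<parallel> assoc \<A> (y \<bullet> x) w v"
  let ?P' = "(assoc \<A> x w v \<div> hcid \<A> y) \<parallel> (assoc \<A> y (x \<bullet> w) v \<parallel> (hcid \<A> v \<div> assoc \<A> y x w))"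
  have below: "(assoc \<A> x w v \<div> hcid \<A> y) \<parallel> (assoc_inv \<A> x w v \<div> hcid \<A> y)
      = hcid \<A> (y \<bullet> (x \<bullet> (w \<bullet> v)))"
    using assms by (simp flip: whisker_below)
  have above: "(hcid \<A> v \<div> assoc \<A> y x w) \<parallel> ((hcid \<A> v \<div> assoc_inv \<A> y x w) \<parallel> \<gamma>) = \<gamma>"
    if "\<gamma> \<in> Cel \<A>" "cleft \<A> \<gamma> = (y \<bullet> (x \<bullet> w)) \<bullet> v" for \<gamma>
    using assms that by (simp flip: hpaste_assoc_simp whisker_above)
  have "?L = ?L \<parallel> (?P' \<parallel> ?R)" using assms by (simp add: above below)
  also have "\<dots> = ?L \<parallel> (?P \<parallel> ?R)" using assoc_pentagon[of v w x y] assms by simp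
  also have "\<dots> = ?R" using assms by simp
  finally show ?thesis .
qed

lemma assoc_inv_unit_middle [simp]:
  assumes "v \<in> Ver \<A>" "w \<in> Ver \<A>" "vcod \<A> v = b" "vdom \<A> w = b"
  shows "assoc_inv \<A> w (vid \<A> b) v = hcid \<A> (w \<bullet> v)"
proof -
  have b: "b \<in> Obj \<A>" using assms by auto
  then show ?thesis using assoc_simps(11)[of v "vid \<A> b" w] assms by simp
qed

end

section \<open>Two dualities\<close>

text \<open>The exchange of left and right.  Since globular cells are reversed, the associator and its inverse
  change places.  A conjoint of \<open>f\<close> in the horizontal opposite is a companion of \<open>f\<close>.\<close>

definition horizontal_opposite :: "('o,'h,'v,'c) dblcat \<Rightarrow> ('o,'h,'v,'c) dblcat" where
  "horizontal_opposite \<A> = \<A>\<lparr>hdom := hcod \<A>, hcod := hdom \<A>, hcomp := \<lambda>g f. f \<cdot>\<^bsub>\<A>\<^esub> g,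
     cleft := cright \<A>, cright := cleft \<A>, hpaste := \<lambda>\<alpha> \<beta>. \<beta> \<parallel>\<^bsub>\<A>\<^esub> \<alpha>,
     assoc := assoc_inv \<A>, assoc_inv := assoc \<A>\<rparr>"

text \<open>The rotation of the plane by a half turn.  A globular cell is reversed and so is the order of
  vertical composition; the two effects cancel on the associator, which stays an associator with its
  arguments in the opposite order.\<close>

definition half_turn :: "('o,'h,'v,'c) dblcat \<Rightarrow> ('o,'h,'v,'c) dblcat" where
  "half_turn \<A> = \<A>\<lparr>hdom := hcod \<A>, hcod := hdom \<A>, hcomp := \<lambda>g f. f \<cdot>\<^bsub>\<A>\<^esub> g,
     vdom := vcod \<A>, vcod := vdom \<A>, vcomp := \<lambda>w v. v \<bullet>\<^bsub>\<A>\<^esub> w,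
     ctop := cbot \<A>, cbot := ctop \<A>, cleft := cright \<A>, cright := cleft \<A>,
     hpaste := \<lambda>\<alpha> \<beta>. \<beta> \<parallel>\<^bsub>\<A>\<^esub> \<alpha>, vpaste := \<lambda>\<alpha> \<beta>. \<beta> \<div>\<^bsub>\<A>\<^esub> \<alpha>,
     assoc := \<lambda>x w v. assoc \<A> v w x, assoc_inv := \<lambda>x w v. assoc_inv \<A> v w x\<rparr>"

lemma horizontal_opposite_simps [simp]:
  "Obj (horizontal_opposite \<A>) = Obj \<A>" "Hor (horizontal_opposite \<A>) = Hor \<A>" "Ver (horizontal_opposite \<A>) = Ver \<A>" "Cel (horizontal_opposite \<A>) = Cel \<A>"
  "hdom (horizontal_opposite \<A>) = hcod \<A>" "hcod (horizontal_opposite \<A>) = hdom \<A>" "hid (horizontal_opposite \<A>) = hid \<A>"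
  "g \<cdot>\<^bsub>horizontal_opposite \<A>\<^esub> f = f \<cdot>\<^bsub>\<A>\<^esub> g"
  "vdom (horizontal_opposite \<A>) = vdom \<A>" "vcod (horizontal_opposite \<A>) = vcod \<A>" "vid (horizontal_opposite \<A>) = vid \<A>" "vcomp (horizontal_opposite \<A>) = vcomp \<A>"
  "ctop (horizontal_opposite \<A>) = ctop \<A>" "cbot (horizontal_opposite \<A>) = cbot \<A>" "cleft (horizontal_opposite \<A>) = cright \<A>"
  "cright (horizontal_opposite \<A>) = cleft \<A>" "hcid (horizontal_opposite \<A>) = hcid \<A>" "vcid (horizontal_opposite \<A>) = vcid \<A>"
  "\<alpha> \<parallel>\<^bsub>horizontal_opposite \<A>\<^esub> \<beta> = \<beta> \<parallel>\<^bsub>\<A>\<^esub> \<alpha>" "vpaste (horizontal_opposite \<A>) = vpaste \<A>"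
  "assoc (horizontal_opposite \<A>) = assoc_inv \<A>" "assoc_inv (horizontal_opposite \<A>) = assoc \<A>"
  "cell (horizontal_opposite \<A>) \<gamma> f v w h = cell \<A> \<gamma> f w v h" "cells (horizontal_opposite \<A>) f v w h = cells \<A> f w v h"
  "varrow (horizontal_opposite \<A>) = varrow \<A>" "harrow (horizontal_opposite \<A>) f a b = harrow \<A> f b a"
  by (auto simp: horizontal_opposite_def cell_def cells_def varrow_def harrow_def fun_eq_iff)

lemma half_turn_simps [simp]:
  "Obj (half_turn \<A>) = Obj \<A>" "Hor (half_turn \<A>) = Hor \<A>" "Ver (half_turn \<A>) = Ver \<A>" "Cel (half_turn \<A>) = Cel \<A>"
  "hdom (half_turn \<A>) = hcod \<A>" "hcod (half_turn \<A>) = hdom \<A>" "hid (half_turn \<A>) = hid \<A>"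
  "g \<cdot>\<^bsub>half_turn \<A>\<^esub> f = f \<cdot>\<^bsub>\<A>\<^esub> g"
  "vdom (half_turn \<A>) = vcod \<A>" "vcod (half_turn \<A>) = vdom \<A>" "vid (half_turn \<A>) = vid \<A>"
  "w \<bullet>\<^bsub>half_turn \<A>\<^esub> v = v \<bullet>\<^bsub>\<A>\<^esub> w"
  "ctop (half_turn \<A>) = cbot \<A>" "cbot (half_turn \<A>) = ctop \<A>" "cleft (half_turn \<A>) = cright \<A>"
  "cright (half_turn \<A>) = cleft \<A>" "hcid (half_turn \<A>) = hcid \<A>" "vcid (half_turn \<A>) = vcid \<A>"
  "\<alpha> \<parallel>\<^bsub>half_turn \<A>\<^esub> \<beta> = \<beta> \<parallel>\<^bsub>\<A>\<^esub> \<alpha>" "\<alpha> \<div>\<^bsub>half_turn \<A>\<^esub> \<beta> = \<beta> \<div>\<^bsub>\<A>\<^esub> \<alpha>"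
  "assoc (half_turn \<A>) x w v = assoc \<A> v w x" "assoc_inv (half_turn \<A>) x w v = assoc_inv \<A> v w x"
  "cell (half_turn \<A>) \<gamma> f v w h = cell \<A> \<gamma> h w v f" "cells (half_turn \<A>) f v w h = cells \<A> h w v f"
  "varrow (half_turn \<A>) v a b = varrow \<A> v b a" "harrow (half_turn \<A>) f a b = harrow \<A> f b a"
  by (auto simp: half_turn_def cell_def cells_def varrow_def harrow_def)

context double_category
begin

lemma double_category_horizontal_opposite: "double_category (horizontal_opposite \<A>)"
  by unfold_locales
    (auto simp: cell_def varrow_def harrow_def globular_def pentagon_inv paste_interchange
      assoc_inv_natural)

lemma double_category_half_turn: "double_category (half_turn \<A>)"
  by unfold_locales
    (auto simp: cell_def varrow_def harrow_def globular_def assoc_pentagon paste_interchange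
      assoc_naturality)

text \<open>A half turn exchanges the two structure cells of a conjoint, so the notion is self-dual.\<close>

lemma is_conjoint_half_turn: "is_conjoint \<A> f p \<alpha> \<beta> \<Longrightarrow> is_conjoint (half_turn \<A>) f p \<beta> \<alpha>"
  by (auto simp: is_conjoint_def)

section \<open>Cells as globular cells between conjoints\<close>

text \<open>Pasting \<open>\<beta>\<close> on top is undone by pasting \<open>\<alpha>\<close>, extended below by the identity of \<open>v\<close>, on the left.
  By interchange the two round trips are governed by \<open>\<alpha> \<parallel> \<beta> = vcid f\<close> and \<open>\<beta> \<div> \<alpha> = hcid p\<close>
  respectively.\<close>

lemma bij_betw_conjoint_left:
  assumes p: "is_conjoint \<A> f p \<alpha> \<beta>" and f: "harrow \<A> f a b" and v: "varrow \<A> v a c"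
    and w: "varrow \<A> w b d"
  shows "bij_betw (\<lambda>\<theta>. \<beta> \<div> \<theta>) (cells \<A> f v w g) (cells \<A> (hid \<A> b) (v \<bullet> p) w g)"
proof (rule bij_betw_byWitness[where f' = "\<lambda>\<theta>. (\<alpha> \<div> hcid \<A> v) \<parallel> \<theta>"])
  have [simp]: "a \<in> Obj \<A>" "b \<in> Obj \<A>" using f by (auto simp: harrow_def)
  note [simp] = p[unfolded is_conjoint_def cell_def varrow_def] f[unfolded harrow_def]
    v[unfolded varrow_def] w[unfolded varrow_def]
  \<comment> \<open>Both associators in this instance of naturality have a unit argument.\<close>
  have unit: "\<beta> \<div> (\<alpha> \<div> hcid \<A> v) = hcid \<A> (v \<bullet> p)"
    using assoc_naturality[of \<beta> \<alpha> "hcid \<A> v"] by simp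
  show "\<forall>\<theta>\<in>cells \<A> f v w g. (\<alpha> \<div> hcid \<A> v) \<parallel> (\<beta> \<div> \<theta>) = \<theta>"
    by (rule ballI) (simp add: cells_def cell_def flip: paste_interchange)
  show "\<forall>\<theta>\<in>cells \<A> (hid \<A> b) (v \<bullet> p) w g. \<beta> \<div> ((\<alpha> \<div> hcid \<A> v) \<parallel> \<theta>) = \<theta>"
  proof
    fix \<theta> assume "\<theta> \<in> cells \<A> (hid \<A> b) (v \<bullet> p) w g"
    then show "\<beta> \<div> ((\<alpha> \<div> hcid \<A> v) \<parallel> \<theta>) = \<theta>"
      using paste_interchange[of \<beta> "vcid \<A> (hid \<A> b)" "\<alpha> \<div> hcid \<A> v" \<theta>]
      by (simp add: cells_def cell_def unit)
  qed
  show "(\<lambda>\<theta>. \<beta> \<div> \<theta>) ` cells \<A> f v w g \<subseteq> cells \<A> (hid \<A> b) (v \<bullet> p) w g"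
  proof (rule image_subsetI)
    fix \<theta> assume "\<theta> \<in> cells \<A> f v w g"
    then have "cell \<A> \<theta> f v w g" by (simp add: cells_def)
    note [simp] = cell_facts[OF this]
    show "\<beta> \<div> \<theta> \<in> cells \<A> (hid \<A> b) (v \<bullet> p) w g" by (simp add: cells_def cell_def)
  qed
  show "(\<lambda>\<theta>. (\<alpha> \<div> hcid \<A> v) \<parallel> \<theta>) ` cells \<A> (hid \<A> b) (v \<bullet> p) w g \<subseteq> cells \<A> f v w g"
  proof (rule image_subsetI)
    fix \<theta> assume "\<theta> \<in> cells \<A> (hid \<A> b) (v \<bullet> p) w g"
    then have "cell \<A> \<theta> (hid \<A> b) (v \<bullet> p) w g" by (simp add: cells_def)
    note [simp] = cell_facts[OF this]
    show "(\<alpha> \<div> hcid \<A> v) \<parallel> \<theta> \<in> cells \<A> f v w g" by (simp add: cells_def cell_def)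
  qed
qed

text \<open>This is the previous bijection after a half turn, which makes the bottom the top.\<close>

lemma bij_betw_conjoint_right:
  assumes "is_conjoint \<A> g q \<alpha> \<beta>" and "harrow \<A> g c d" and "varrow \<A> v a c" and "varrow \<A> w b d"
  shows "bij_betw (\<lambda>\<theta>. \<theta> \<div> \<alpha>) (cells \<A> f v w g) (cells \<A> f v (q \<bullet> w) (hid \<A> c))"
  using double_category.bij_betw_conjoint_left[OF double_category_half_turn is_conjoint_half_turn, of g q \<alpha> \<beta> d c w b v a f] assms
  by simp

lemma eqpoll_cells_conjoints:
  assumes "is_conjoint \<A> f p \<alpha> \<beta>" and "harrow \<A> f a b" and "varrow \<A> v a c"
    and "is_conjoint \<A> g q \<alpha>' \<beta>'" and "harrow \<A> g c d" and "varrow \<A> w b d"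
  shows "cells \<A> f v w g \<approx> cells \<A> (hid \<A> b) (v \<bullet> p) (q \<bullet> w) (hid \<A> c)"
proof -
  have "varrow \<A> (v \<bullet> p) b c"
    using assms(1-3) by (auto simp: is_conjoint_def varrow_def harrow_def)
  from bij_betw_conjoint_right[OF assms(4,5) this assms(6)]
    bij_betw_conjoint_left[OF assms(1,2,3,6)]
  show ?thesis unfolding eqpoll_def using bij_betw_trans by blast
qed

section \<open>Mates under vertical adjunctions\<close>

lemma ver_adjunction_facts:
  assumes adj: "ver_adjunction \<A> v x \<eta> \<epsilon>" and v: "varrow \<A> v a c"
  shows "x \<in> Ver \<A>" "vdom \<A> x = c" "vcod \<A> x = a" "v \<in> Ver \<A>" "vdom \<A> v = a" "vcod \<A> v = c"
    "\<eta> \<in> Cel \<A>" "ctop \<A> \<eta> = hid \<A> a" "cleft \<A> \<eta> = vid \<A> a" "cright \<A> \<eta> = x \<bullet> v" "cbot \<A> \<eta> = hid \<A> a"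
    "\<epsilon> \<in> Cel \<A>" "ctop \<A> \<epsilon> = hid \<A> c" "cleft \<A> \<epsilon> = v \<bullet> x" "cright \<A> \<epsilon> = vid \<A> c" "cbot \<A> \<epsilon> = hid \<A> c"
    "a \<in> Obj \<A>" "c \<in> Obj \<A>"
  using assms by (auto simp: ver_adjunction_def globular_def cell_def varrow_def)

text \<open>Taking the mate \<open>p \<Rightarrow> x \<bullet> q\<close> of \<open>\<theta> : v \<bullet> p \<Rightarrow> q\<close> with the unit and then going back with the counit
  yields \<open>\<theta>\<close>: naturality moves \<open>\<theta>\<close> past the counit to the far right, and what precedes it is, by the
  pentagon, a triangle identity whiskered with \<open>p\<close>.  The top \<open>f\<close> is arbitrary since only the
  bottom of \<open>\<theta>\<close> meets the unit and the counit.\<close>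

lemma mate_round_trip:
  assumes adj: "ver_adjunction \<A> v x \<eta> \<epsilon>"
    and p: "varrow \<A> p e a" and q: "varrow \<A> q e' c" and v: "varrow \<A> v a c"
    and \<theta>: "cell \<A> \<theta> f (v \<bullet> p) q (hid \<A> c)"
  shows "(((hcid \<A> p \<div> \<eta>) \<parallel> assoc_inv \<A> x v p \<parallel> (\<theta> \<div> hcid \<A> x)) \<div> hcid \<A> v)
           \<parallel> assoc \<A> v x q \<parallel> (hcid \<A> q \<div> \<epsilon>) = \<theta>"
proof -
  have [simp]: "a \<in> Obj \<A>" "c \<in> Obj \<A>" "e \<in> Obj \<A>" "e' \<in> Obj \<A>"
    using p q v by (auto simp: varrow_def)
  note [simp] = ver_adjunction_facts[OF adj v] p[unfolded varrow_def] q[unfolded varrow_def]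
    cell_facts[OF \<theta>]
  have triangle: "(\<eta> \<div> hcid \<A> v) \<parallel> (assoc \<A> v x v \<parallel> (hcid \<A> v \<div> \<epsilon>)) = hcid \<A> v"
    using adj by (simp add: ver_adjunction_def)
  have slide_\<theta>: "((\<theta> \<div> hcid \<A> x) \<div> hcid \<A> v) \<parallel> assoc \<A> v x q
      = assoc \<A> v x (v \<bullet> p) \<parallel> (\<theta> \<div> hcid \<A> (v \<bullet> x))"
    using assoc_naturality[of \<theta> "hcid \<A> x" "hcid \<A> v"] by simp
  have swap: "(\<theta> \<div> hcid \<A> (v \<bullet> x)) \<parallel> (hcid \<A> q \<div> \<epsilon>) = (hcid \<A> (v \<bullet> p) \<div> \<epsilon>) \<parallel> \<theta>"
    using paste_interchange[of \<theta> "hcid \<A> q" "hcid \<A> (v \<bullet> x)" \<epsilon>]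
      paste_interchange[of "hcid \<A> (v \<bullet> p)" \<theta> \<epsilon> "vcid \<A> (hid \<A> c)"] by simp
  have slide_\<epsilon>: "hcid \<A> (v \<bullet> p) \<div> \<epsilon> = assoc \<A> (v \<bullet> x) v p \<parallel> (hcid \<A> p \<div> (hcid \<A> v \<div> \<epsilon>))"
    using assoc_naturality[of "hcid \<A> p" "hcid \<A> v" \<epsilon>] by simp
  have slide_\<eta>: "((hcid \<A> p \<div> \<eta>) \<div> hcid \<A> v) \<parallel> assoc \<A> v (x \<bullet> v) p
      = hcid \<A> p \<div> (\<eta> \<div> hcid \<A> v)"
    using assoc_naturality[of "hcid \<A> p" \<eta> "hcid \<A> v"] by simp
  have pent: "(assoc_inv \<A> x v p \<div> hcid \<A> v) \<parallel> (assoc \<A> v x (v \<bullet> p) \<parallel> assoc \<A> (v \<bullet> x) v p)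
      = assoc \<A> v (x \<bullet> v) p \<parallel> (hcid \<A> p \<div> assoc \<A> v x v)"
  proof -
    have "(assoc_inv \<A> x v p \<div> hcid \<A> v) \<parallel> ((assoc \<A> x v p \<div> hcid \<A> v) \<parallel> \<gamma>) = \<gamma>"
      if "\<gamma> \<in> Cel \<A>" "cleft \<A> \<gamma> = v \<bullet> ((x \<bullet> v) \<bullet> p)" for \<gamma>
      using that by (simp flip: hpaste_assoc_simp whisker_below)
    then show ?thesis by (simp add: assoc_pentagon)
  qed
  have "(((hcid \<A> p \<div> \<eta>) \<parallel> assoc_inv \<A> x v p \<parallel> (\<theta> \<div> hcid \<A> x)) \<div> hcid \<A> v)
           \<parallel> assoc \<A> v x q \<parallel> (hcid \<A> q \<div> \<epsilon>)
      = ((hcid \<A> p \<div> \<eta>) \<div> hcid \<A> v) \<parallel> ((assoc_inv \<A> x v p \<div> hcid \<A> v) \<parallel>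
          ((((\<theta> \<div> hcid \<A> x) \<div> hcid \<A> v) \<parallel> assoc \<A> v x q) \<parallel> (hcid \<A> q \<div> \<epsilon>)))"
    by (simp add: whisker_below)
  also have "\<dots> = ((hcid \<A> p \<div> \<eta>) \<div> hcid \<A> v) \<parallel> ((assoc_inv \<A> x v p \<div> hcid \<A> v) \<parallel>
          (assoc \<A> v x (v \<bullet> p) \<parallel> ((\<theta> \<div> hcid \<A> (v \<bullet> x)) \<parallel> (hcid \<A> q \<div> \<epsilon>))))"
    unfolding slide_\<theta> by simp
  also have "\<dots> = ((hcid \<A> p \<div> \<eta>) \<div> hcid \<A> v) \<parallel>
          (((assoc_inv \<A> x v p \<div> hcid \<A> v) \<parallel> (assoc \<A> v x (v \<bullet> p) \<parallel> assoc \<A> (v \<bullet> x) v p)) \<parallel>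
          ((hcid \<A> p \<div> (hcid \<A> v \<div> \<epsilon>)) \<parallel> \<theta>))"
    unfolding swap slide_\<epsilon> by simp
  also have "\<dots> = (((hcid \<A> p \<div> \<eta>) \<div> hcid \<A> v) \<parallel> assoc \<A> v (x \<bullet> v) p) \<parallel>
          ((hcid \<A> p \<div> assoc \<A> v x v) \<parallel> ((hcid \<A> p \<div> (hcid \<A> v \<div> \<epsilon>)) \<parallel> \<theta>))"
    unfolding pent by simp
  also have "\<dots> = (hcid \<A> p \<div> ((\<eta> \<div> hcid \<A> v) \<parallel> (assoc \<A> v x v \<parallel> (hcid \<A> v \<div> \<epsilon>)))) \<parallel> \<theta>"
    unfolding slide_\<eta> by (simp add: whisker_above)
  also have "\<dots> = \<theta>" unfolding triangle by simp
  finally show ?thesis .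
qed

text \<open>Exchanging left and right reverses the 2-cells of the vertical bicategory, hence also exchanges
  left and right adjoints.  A half turn reverses the arrows as well, so that \<open>v\<close> is again the left
  adjoint; in both cases unit and counit change places.\<close>

lemma ver_adjunction_horizontal_opposite:
  assumes "ver_adjunction \<A> v x \<eta> \<epsilon>"
  shows "ver_adjunction (horizontal_opposite \<A>) x v \<epsilon> \<eta>"
  using assms by (auto simp: ver_adjunction_def globular_def cell_def varrow_def)

lemma ver_adjunction_half_turn:
  assumes "ver_adjunction \<A> v x \<eta> \<epsilon>"
  shows "ver_adjunction (half_turn \<A>) v x \<epsilon> \<eta>"
  using assms by (auto simp: ver_adjunction_def globular_def cell_def varrow_def)

text \<open>In the horizontal opposite, where \<open>x\<close> is left adjoint to \<open>v\<close>, the map from right to left is the map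
  that sends a cell to its mate.  The second round trip is therefore the first one of the opposite.\<close>

lemma bij_betw_mate_left:
  assumes adj: "ver_adjunction \<A> v x \<eta> \<epsilon>"
    and p: "varrow \<A> p e a" and q: "varrow \<A> q e' c" and v: "varrow \<A> v a c"
  shows "bij_betw (\<lambda>\<theta>. (hcid \<A> p \<div> \<eta>) \<parallel> assoc_inv \<A> x v p \<parallel> (\<theta> \<div> hcid \<A> x))
    (cells \<A> f (v \<bullet> p) q (hid \<A> c)) (cells \<A> f p (x \<bullet> q) (hid \<A> a))"
proof (rule bij_betw_byWitness[where
      f' = "\<lambda>\<phi>. (\<phi> \<div> hcid \<A> v) \<parallel> assoc \<A> v x q \<parallel> (hcid \<A> q \<div> \<epsilon>)"])
  have [simp]: "a \<in> Obj \<A>" "c \<in> Obj \<A>" "e \<in> Obj \<A>" "e' \<in> Obj \<A>"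
    using p q v by (auto simp: varrow_def)
  note [simp] = ver_adjunction_facts[OF adj v] p[unfolded varrow_def] q[unfolded varrow_def]
  have x: "varrow \<A> x c a" by (simp add: varrow_def)
  show "\<forall>\<theta>\<in>cells \<A> f (v \<bullet> p) q (hid \<A> c).
      ((((hcid \<A> p \<div> \<eta>) \<parallel> assoc_inv \<A> x v p \<parallel> (\<theta> \<div> hcid \<A> x)) \<div> hcid \<A> v)
           \<parallel> assoc \<A> v x q \<parallel> (hcid \<A> q \<div> \<epsilon>)) = \<theta>"
    using mate_round_trip[OF adj p q v] by (simp add: cells_def)
  show "\<forall>\<phi>\<in>cells \<A> f p (x \<bullet> q) (hid \<A> a). (hcid \<A> p \<div> \<eta>) \<parallel> assoc_inv \<A> x v p
      \<parallel> (((\<phi> \<div> hcid \<A> v) \<parallel> assoc \<A> v x q \<parallel> (hcid \<A> q \<div> \<epsilon>)) \<div> hcid \<A> x) = \<phi>"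
  proof
    fix \<phi> assume "\<phi> \<in> cells \<A> f p (x \<bullet> q) (hid \<A> a)"
    then have \<phi>: "cell \<A> \<phi> f p (x \<bullet> q) (hid \<A> a)" by (simp add: cells_def)
    note [simp] = cell_facts[OF \<phi>]
    from \<phi> show "(hcid \<A> p \<div> \<eta>) \<parallel> assoc_inv \<A> x v p
      \<parallel> (((\<phi> \<div> hcid \<A> v) \<parallel> assoc \<A> v x q \<parallel> (hcid \<A> q \<div> \<epsilon>)) \<div> hcid \<A> x) = \<phi>"
      using double_category.mate_round_trip[OF double_category_horizontal_opposite ver_adjunction_horizontal_opposite[OF adj],
          of q e' c p e a \<phi> f] x p q
      by (simp add: cell_def)
  qed
  show "(\<lambda>\<theta>. (hcid \<A> p \<div> \<eta>) \<parallel> assoc_inv \<A> x v p \<parallel> (\<theta> \<div> hcid \<A> x)) `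
      cells \<A> f (v \<bullet> p) q (hid \<A> c) \<subseteq> cells \<A> f p (x \<bullet> q) (hid \<A> a)"
  proof (rule image_subsetI)
    fix \<theta> assume "\<theta> \<in> cells \<A> f (v \<bullet> p) q (hid \<A> c)"
    then have "cell \<A> \<theta> f (v \<bullet> p) q (hid \<A> c)" by (simp add: cells_def)
    note [simp] = cell_facts[OF this]
    show "(hcid \<A> p \<div> \<eta>) \<parallel> assoc_inv \<A> x v p \<parallel> (\<theta> \<div> hcid \<A> x)
        \<in> cells \<A> f p (x \<bullet> q) (hid \<A> a)"
      by (simp add: cells_def cell_def)
  qed
  show "(\<lambda>\<phi>. (\<phi> \<div> hcid \<A> v) \<parallel> assoc \<A> v x q \<parallel> (hcid \<A> q \<div> \<epsilon>)) `
      cells \<A> f p (x \<bullet> q) (hid \<A> a) \<subseteq> cells \<A> f (v \<bullet> p) q (hid \<A> c)"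
  proof (rule image_subsetI)
    fix \<phi> assume "\<phi> \<in> cells \<A> f p (x \<bullet> q) (hid \<A> a)"
    then have "cell \<A> \<phi> f p (x \<bullet> q) (hid \<A> a)" by (simp add: cells_def)
    note [simp] = cell_facts[OF this]
    show "(\<phi> \<div> hcid \<A> v) \<parallel> assoc \<A> v x q \<parallel> (hcid \<A> q \<div> \<epsilon>)
        \<in> cells \<A> f (v \<bullet> p) q (hid \<A> c)"
      by (simp add: cells_def cell_def)
  qed
qed

lemma eqpoll_mate_right:
  assumes "ver_adjunction \<A> w y \<eta> \<epsilon>"
    and "varrow \<A> p b e" and "varrow \<A> q d e'" and "varrow \<A> w b d"
  shows "cells \<A> (hid \<A> b) p (q \<bullet> w) g \<approx> cells \<A> (hid \<A> d) (p \<bullet> y) q g"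
  unfolding eqpoll_def
  using double_category.bij_betw_mate_left[OF double_category_half_turn ver_adjunction_half_turn[OF assms(1)],
      of q e' d p e b g] assms
  by auto

lemma bij_betw_assoc_right:
  assumes "varrow \<A> w b d" "varrow \<A> q d c" "varrow \<A> x c a" "varrow \<A> p e a"
  shows "bij_betw (\<lambda>\<theta>. \<theta> \<parallel> assoc \<A> x q w)
    (cells \<A> f p (x \<bullet> (q \<bullet> w)) (hid \<A> a)) (cells \<A> f p ((x \<bullet> q) \<bullet> w) (hid \<A> a))"
proof -
  note [simp] = assms[unfolded varrow_def]
  have [simp]: "a \<in> Obj \<A>" using ver_obj(2)[of x] by simp
  have forward: "cell \<A> (\<theta> \<parallel> assoc \<A> x q w) f p ((x \<bullet> q) \<bullet> w) (hid \<A> a)"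
    "(\<theta> \<parallel> assoc \<A> x q w) \<parallel> assoc_inv \<A> x q w = \<theta>"
    if "cell \<A> \<theta> f p (x \<bullet> (q \<bullet> w)) (hid \<A> a)" for \<theta>
    using cell_facts[OF that] by (simp_all add: cell_def)
  have backward: "cell \<A> (\<theta> \<parallel> assoc_inv \<A> x q w) f p (x \<bullet> (q \<bullet> w)) (hid \<A> a)"
    "(\<theta> \<parallel> assoc_inv \<A> x q w) \<parallel> assoc \<A> x q w = \<theta>"
    if "cell \<A> \<theta> f p ((x \<bullet> q) \<bullet> w) (hid \<A> a)" for \<theta>
    using cell_facts[OF that] by (simp_all add: cell_def)
  show ?thesis
    by (rule bij_betw_byWitness[where f' = "\<lambda>\<theta>. \<theta> \<parallel> assoc_inv \<A> x q w"])
      (use forward backward in \<open>auto simp: cells_def\<close>)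
qed

section \<open>Companions from horizontal adjunctions\<close>

text \<open>By coherence this applies whenever a unit occurs among the three left sides and among the three
  right sides.\<close>

lemma vpaste_assoc_if_assoc_hcid:
  assumes "\<alpha> \<in> Cel \<A>" "\<beta> \<in> Cel \<A>" "\<gamma> \<in> Cel \<A>" "cbot \<A> \<alpha> = ctop \<A> \<beta>" "cbot \<A> \<beta> = ctop \<A> \<gamma>"
    and right: "assoc \<A> (cright \<A> \<gamma>) (cright \<A> \<beta>) (cright \<A> \<alpha>)
      = hcid \<A> (cright \<A> ((\<alpha> \<div> \<beta>) \<div> \<gamma>))"
    and left: "assoc \<A> (cleft \<A> \<gamma>) (cleft \<A> \<beta>) (cleft \<A> \<alpha>)
      = hcid \<A> (cleft \<A> (\<alpha> \<div> (\<beta> \<div> \<gamma>)))"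
  shows "(\<alpha> \<div> \<beta>) \<div> \<gamma> = \<alpha> \<div> (\<beta> \<div> \<gamma>)"
proof -
  have "(\<alpha> \<div> \<beta>) \<div> \<gamma> \<in> Cel \<A>" "\<alpha> \<div> (\<beta> \<div> \<gamma>) \<in> Cel \<A>" using assms(1-5) by simp_all
  then show ?thesis
    using assoc_naturality[OF assms(1-5)] unfolding left right by (simp del: vpaste_simps)
qed

text \<open>The structure cells of the companion are the structure cells of the conjoint of \<open>h\<close> with \<open>f\<close> put
  beside them, corrected by the unit and the counit.  One equation follows from \<open>\<alpha> \<parallel> \<beta> = vcid h\<close> and
  the triangle identity for \<open>f\<close>, the other from \<open>\<beta> \<div> \<alpha> = hcid p\<close> and the triangle identity for \<open>h\<close>.\<close>

lemma conjoint_of_right_adjoint_is_companion: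
  assumes adj: "hor_adjunction \<A> f h \<eta> \<epsilon>" and p: "is_conjoint \<A> h p \<alpha> \<beta>"
    and f: "harrow \<A> f a b"
  shows "is_conjoint (horizontal_opposite \<A>) f p ((\<beta> \<parallel> vcid \<A> f) \<div> \<epsilon>) (\<eta> \<div> (vcid \<A> f \<parallel> \<alpha>))"
proof -
  have [simp]: "f \<in> Hor \<A>" "hdom \<A> f = a" "hcod \<A> f = b" "h \<in> Hor \<A>" "hdom \<A> h = b" "hcod \<A> h = a"
    using adj f by (auto simp: hor_adjunction_def harrow_def)
  have [simp]: "a \<in> Obj \<A>" "b \<in> Obj \<A>" using hor_obj[of f] by simp_all
  have [simp]: "\<eta> \<in> Cel \<A>" "ctop \<A> \<eta> = hid \<A> a" "cleft \<A> \<eta> = vid \<A> a" "cright \<A> \<eta> = vid \<A> a"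
    "cbot \<A> \<eta> = h \<cdot> f" "\<epsilon> \<in> Cel \<A>" "ctop \<A> \<epsilon> = f \<cdot> h" "cleft \<A> \<epsilon> = vid \<A> b"
    "cright \<A> \<epsilon> = vid \<A> b" "cbot \<A> \<epsilon> = hid \<A> b"
    using adj by (auto simp: hor_adjunction_def hor_2cell_def cell_def)
  have [simp]: "p \<in> Ver \<A>" "vdom \<A> p = a" "vcod \<A> p = b"
    "\<alpha> \<in> Cel \<A>" "ctop \<A> \<alpha> = h" "cleft \<A> \<alpha> = vid \<A> b" "cright \<A> \<alpha> = p" "cbot \<A> \<alpha> = hid \<A> b"
    "\<beta> \<in> Cel \<A>" "ctop \<A> \<beta> = hid \<A> a" "cleft \<A> \<beta> = p" "cright \<A> \<beta> = vid \<A> a" "cbot \<A> \<beta> = h"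
    using p by (auto simp: is_conjoint_def cell_def varrow_def)
  have \<alpha>\<beta>: "\<alpha> \<parallel> \<beta> = vcid \<A> h" and \<beta>\<alpha>: "\<beta> \<div> \<alpha> = hcid \<A> p"
    using p by (auto simp: is_conjoint_def)
  have tri_f: "(\<eta> \<parallel> vcid \<A> f) \<div> (vcid \<A> f \<parallel> \<epsilon>) = vcid \<A> f"
    and tri_h: "(vcid \<A> h \<parallel> \<eta>) \<div> (\<epsilon> \<parallel> vcid \<A> h) = vcid \<A> h"
    using adj by (auto simp: hor_adjunction_def)

  have horizontal: "(\<eta> \<div> (vcid \<A> f \<parallel> \<alpha>)) \<parallel> ((\<beta> \<parallel> vcid \<A> f) \<div> \<epsilon>) = vcid \<A> f"
  proof -
    have mid: "(vcid \<A> f \<parallel> \<alpha>) \<parallel> (\<beta> \<parallel> vcid \<A> f) = vcid \<A> f \<parallel> ((\<alpha> \<parallel> \<beta>) \<parallel> vcid \<A> f)"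
      by simp
    have "(\<eta> \<div> (vcid \<A> f \<parallel> \<alpha>)) \<parallel> ((\<beta> \<parallel> vcid \<A> f) \<div> \<epsilon>)
        = (\<eta> \<div> (vcid \<A> f \<parallel> \<alpha>)) \<parallel> (vcid \<A> f \<div> ((\<beta> \<parallel> vcid \<A> f) \<div> \<epsilon>))"
      by simp
    also have "\<dots> = (\<eta> \<parallel> vcid \<A> f) \<div> ((vcid \<A> f \<parallel> \<alpha>) \<parallel> ((\<beta> \<parallel> vcid \<A> f) \<div> \<epsilon>))"
      by (rule paste_interchange[symmetric]) simp_all
    also have "(vcid \<A> f \<parallel> \<alpha>) \<parallel> ((\<beta> \<parallel> vcid \<A> f) \<div> \<epsilon>)
        = ((vcid \<A> f \<parallel> \<alpha>) \<div> vcid \<A> f) \<parallel> ((\<beta> \<parallel> vcid \<A> f) \<div> \<epsilon>)"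
      by simp
    also have "\<dots> = ((vcid \<A> f \<parallel> \<alpha>) \<parallel> (\<beta> \<parallel> vcid \<A> f)) \<div> (vcid \<A> f \<parallel> \<epsilon>)"
      by (rule paste_interchange[symmetric]) simp_all
    also have "\<dots> = vcid \<A> f \<parallel> \<epsilon>"
      unfolding mid \<alpha>\<beta> by simp
    finally show ?thesis unfolding tri_f .
  qed

  \<comment> \<open>Insert the triangle identity for \<open>h\<close> between \<open>\<beta>\<close> and \<open>\<alpha>\<close>.  The unit then slides up past \<open>\<beta>\<close> and
    the counit slides down past \<open>\<alpha>\<close>; between them remain \<open>\<beta>\<close> on the left and \<open>\<alpha>\<close> on the right, with
    \<open>f\<close> in the middle, and these can change their relative height.\<close>
  let ?X = "vcid \<A> f \<parallel> \<alpha>" and ?Y = "\<beta> \<parallel> vcid \<A> f"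
  let ?X' = "\<beta> \<parallel> vcid \<A> (h \<cdot> f)" and ?Y' = "vcid \<A> (f \<cdot> h) \<parallel> \<alpha>"
  have \<beta>\<eta>: "\<beta> \<div> (vcid \<A> h \<parallel> \<eta>) = \<eta> \<div> ?X'"
    using paste_interchange[of \<beta> "vcid \<A> (hid \<A> a)" "vcid \<A> h" \<eta>]
      paste_interchange[of "vcid \<A> (hid \<A> a)" \<eta> \<beta> "vcid \<A> (h \<cdot> f)"] by simp
  have \<epsilon>\<alpha>: "(\<epsilon> \<parallel> vcid \<A> h) \<div> \<alpha> = ?Y' \<div> \<epsilon>"
    using paste_interchange[of \<epsilon> "vcid \<A> h" "vcid \<A> (hid \<A> b)" \<alpha>]
      paste_interchange[of "vcid \<A> (f \<cdot> h)" \<alpha> \<epsilon> "vcid \<A> (hid \<A> b)"] by simp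
  have "?X' \<div> ?Y' = (\<beta> \<parallel> (vcid \<A> f \<parallel> vcid \<A> h)) \<div> (vcid \<A> h \<parallel> (vcid \<A> f \<parallel> \<alpha>))"
    by (simp flip: hpaste_assoc_simp)
  also have "\<dots> = (\<beta> \<div> vcid \<A> h) \<parallel> ((vcid \<A> f \<parallel> vcid \<A> h) \<div> (vcid \<A> f \<parallel> \<alpha>))"
    by (rule paste_interchange) simp_all
  also have "\<dots> = \<beta> \<parallel> (vcid \<A> f \<parallel> \<alpha>)"
    using paste_interchange[of "vcid \<A> f" "vcid \<A> h" "vcid \<A> f" \<alpha>] by simp
  also have "\<dots> = ?X \<div> ?Y"
    using paste_interchange[of "vcid \<A> (hid \<A> a)" ?X \<beta> "vcid \<A> f"] by simp
  finally have slide: "?X' \<div> ?Y' = ?X \<div> ?Y" .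

  have "hcid \<A> p = \<beta> \<div> (((vcid \<A> h \<parallel> \<eta>) \<div> (\<epsilon> \<parallel> vcid \<A> h)) \<div> \<alpha>)"
    unfolding tri_h by (simp add: \<beta>\<alpha>)
  also have "((vcid \<A> h \<parallel> \<eta>) \<div> (\<epsilon> \<parallel> vcid \<A> h)) \<div> \<alpha>
      = (vcid \<A> h \<parallel> \<eta>) \<div> ((\<epsilon> \<parallel> vcid \<A> h) \<div> \<alpha>)"
    by (rule vpaste_assoc_if_assoc_hcid) simp_all
  also have "\<beta> \<div> \<dots> = (\<beta> \<div> (vcid \<A> h \<parallel> \<eta>)) \<div> ((\<epsilon> \<parallel> vcid \<A> h) \<div> \<alpha>)"
    by (rule vpaste_assoc_if_assoc_hcid[symmetric]) simp_all
  also have "\<dots> = (\<eta> \<div> ?X') \<div> (?Y' \<div> \<epsilon>)" unfolding \<beta>\<eta> \<epsilon>\<alpha> ..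
  also have "\<dots> = \<eta> \<div> (?X' \<div> (?Y' \<div> \<epsilon>))" by (rule vpaste_assoc_if_assoc_hcid) simp_all
  also have "?X' \<div> (?Y' \<div> \<epsilon>) = (?X' \<div> ?Y') \<div> \<epsilon>"
    by (rule vpaste_assoc_if_assoc_hcid[symmetric]) simp_all
  also have "\<dots> = ?X \<div> (?Y \<div> \<epsilon>)" unfolding slide by (rule vpaste_assoc_if_assoc_hcid) simp_all
  also have "\<eta> \<div> \<dots> = (\<eta> \<div> ?X) \<div> (?Y \<div> \<epsilon>)"
    by (rule vpaste_assoc_if_assoc_hcid[symmetric]) simp_all
  finally have vertical: "(\<eta> \<div> ?X) \<div> (?Y \<div> \<epsilon>) = hcid \<A> p" ..

  show ?thesis
    using horizontal vertical by (simp add: is_conjoint_def cell_def varrow_def)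
qed

end

section \<open>Cells and coretrocells\<close>

theorem theorem4p1:
  fixes \<A> :: "('o,'h,'v,'c) dblcat"
    and cj :: "'h \<Rightarrow> 'v" and cj\<alpha> cj\<beta> :: "'h \<Rightarrow> 'c"
    and a b c d :: 'o and f g :: 'h and v w :: 'v
  assumes "double_category_with_conjoints \<A> cj cj\<alpha> cj\<beta>"
    and "harrow \<A> f a b" and "harrow \<A> g c d"
    and "varrow \<A> v a c" and "varrow \<A> w b d"
  shows "(\<forall>x y. varrow \<A> x c a \<and> varrow \<A> y d b \<and>
                ver_right_adjoint \<A> x v \<and> ver_right_adjoint \<A> y w \<longrightarrow>
             (\<exists>\<phi>. bij_betw \<phi> (cells \<A> f v w g) (coretrocells \<A> cj g x y f)))
       \<and> (\<forall>h k. harrow \<A> h b a \<and> harrow \<A> k d c \<and>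
                hor_right_adjoint \<A> h f \<and> hor_right_adjoint \<A> k g \<longrightarrow>
             (\<exists>\<phi>. bij_betw \<phi> (cells \<A> f v w g) (coretrocells \<A> cj h w v k)))"
proof (intro conjI allI impI)
  interpret double_category_with_conjoints \<A> cj cj\<alpha> cj\<beta> by fact
  note f = assms(2) and g = assms(3) and v = assms(4) and w = assms(5)
  have conj: "is_conjoint \<A> k (cj k) (cj\<alpha> k) (cj\<beta> k)" "varrow \<A> (cj k) t s" if "harrow \<A> k s t" for k s t
    using conjoint[of k] that by (auto simp: harrow_def is_conjoint_def)
  {
    fix x y
    assume "varrow \<A> x c a \<and> varrow \<A> y d b \<and> ver_right_adjoint \<A> x v \<and> ver_right_adjoint \<A> y w"
    then obtain \<eta> \<epsilon> \<eta>' \<epsilon>' where x: "varrow \<A> x c a" and y: "varrow \<A> y d b"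
      and vx: "ver_adjunction \<A> v x \<eta> \<epsilon>" and wy: "ver_adjunction \<A> w y \<eta>' \<epsilon>'"
      by (auto simp: ver_right_adjoint_def)
    note f' = conj(2)[OF f] and g' = conj(2)[OF g]
    have "cells \<A> f v w g \<approx> cells \<A> (hid \<A> b) (v \<bullet>\<^bsub>\<A>\<^esub> cj f) (cj g \<bullet>\<^bsub>\<A>\<^esub> w) (hid \<A> c)"
      by (rule eqpoll_cells_conjoints[OF conj(1)[OF f] f v conj(1)[OF g] g w])
    also have "\<dots> \<approx> cells \<A> (hid \<A> b) (cj f) (x \<bullet>\<^bsub>\<A>\<^esub> (cj g \<bullet>\<^bsub>\<A>\<^esub> w)) (hid \<A> a)"
      using bij_betw_mate_left[OF vx f' vcomp_arrow[OF w g'] v] unfolding eqpoll_def by blast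
    also have "\<dots> \<approx> cells \<A> (hid \<A> b) (cj f) ((x \<bullet>\<^bsub>\<A>\<^esub> cj g) \<bullet>\<^bsub>\<A>\<^esub> w) (hid \<A> a)"
      using bij_betw_assoc_right[OF w g' x f'] unfolding eqpoll_def by blast
    also have "\<dots> \<approx> cells \<A> (hid \<A> d) (cj f \<bullet>\<^bsub>\<A>\<^esub> y) (x \<bullet>\<^bsub>\<A>\<^esub> cj g) (hid \<A> a)"
      by (rule eqpoll_mate_right[OF wy f' vcomp_arrow[OF g' x] w])
    also have "\<dots> = coretrocells \<A> cj g x y f"
      using f' g' x y
      by (simp add: coretrocells_def cells_def globular_def varrow_def)
    finally show "\<exists>\<phi>. bij_betw \<phi> (cells \<A> f v w g) (coretrocells \<A> cj g x y f)"
      unfolding eqpoll_def .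
  next
    fix h k
    assume "harrow \<A> h b a \<and> harrow \<A> k d c \<and> hor_right_adjoint \<A> h f \<and> hor_right_adjoint \<A> k g"
    then obtain \<eta> \<epsilon> \<eta>' \<epsilon>' where h: "harrow \<A> h b a" and k: "harrow \<A> k d c"
      and fh: "hor_adjunction \<A> f h \<eta> \<epsilon>" and gk: "hor_adjunction \<A> g k \<eta>' \<epsilon>'"
      by (auto simp: hor_right_adjoint_def)
    interpret op: double_category "horizontal_opposite \<A>"
      by (rule double_category_horizontal_opposite)
    note k' = conj(2)[OF k]
    have "cells \<A> f v w g = cells (horizontal_opposite \<A>) f w v g"
      by simp
    also have "\<dots> \<approx> cells (horizontal_opposite \<A>) (hid \<A> a) (w \<bullet>\<^bsub>\<A>\<^esub> cj h) (cj k \<bullet>\<^bsub>\<A>\<^esub> v) (hid \<A> d)"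
      using op.eqpoll_cells_conjoints[OF conjoint_of_right_adjoint_is_companion[OF fh conj(1)[OF h] f] _ _
          conjoint_of_right_adjoint_is_companion[OF gk conj(1)[OF k] g], of b a w d c v] f g v w
      unfolding horizontal_opposite_simps by blast
    also have "\<dots> = coretrocells \<A> cj h w v k"
      using k' v by (simp add: coretrocells_def cells_def globular_def varrow_def)
    finally show "\<exists>\<phi>. bij_betw \<phi> (cells \<A> f v w g) (coretrocells \<A> cj h w v k)"
      unfolding eqpoll_def .
  }
qed

end
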